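(* Let $\mathcal G=(\mathcal V,\mathcal E)$ be a terminating graph in which each terminal node has been assigned a positive value. Let $M$ be the propagation matrix of $\mathcal G$, let $v=(v_i:i\in\mathcal V)$ be the vector of limiting values, and let $V=\mathrm{diag}(v)$. Suppose the players use the limiting strategies (with any parameter $\beta\in(0,1]$). Then the Chooser's transition probability matrix $P=(p_{i,j})_{i,j\in\mathcal V}$ satisfies $$P=VMV^{-1},$$ the game duration $T$ is finite with probability $1$, and the Guesser's expected fortune at the end of the game equals the value of the node at which play began: for every $i\in\mathcal V$, $$E[F_T\mid X_0=i]=v_i.$$
   Context: Graphs. $\mathcal G$ is a finite directed graph (at most one edge from $i$ to $j$; loops allowed); $i\to j$ means there is an edge from $i$ to $j$, and $n_i$ is the out-degree of $i$. A node is terminal if its out-degree is $0$; each terminal node $j$ carries a pre-assigned positive value $v_j$. A terminating graph is a connected digraph in which every non-terminal node has a directed path to some terminal node. Path Guessing Game. The players share a position $X_t\in\mathcal V$ and the Guesser's initial fortune is $1$. At a non-terminal node $i$, the Guesser wagers a proportion $w\in[0,1]$ of her current fortune (announced) and makes a secret random guess among the out-neighbours of $i$; the Chooser, independently of the guess, selects an out-neighbour $j$ of $i$. The fortune is multiplied by $1+(n_i-1)w$ if $n_i\ge2$ and the guess was $j$; by $1+w$ if $n_i=1$; and by $1-w$ if the guess was wrong. The players move to $j$. If $j$ is terminal the fortune is multiplied by $v_j$ and the game ends; otherwise play continues. $T=\min\{t\ge0: X_t\text{ is terminal}\}$ is the game duration and $F_T$ is the Guesser's fortune at the end of the game, including the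 final multiplication by the value of the terminal node (so $F_T=v_i$ if play starts at a terminal node $i$). Propagation matrix: $M=(m_{i,j})$ with $m_{i,i}=1$ for $i$ terminal; $m_{i,j}=1/2$ if $n_i=1$ and $i\to j$; $m_{i,j}=1/n_i$ if $n_i\ge2$ and $i\to j$; and $m_{i,j}=0$ otherwise. Limiting values: let $u_0$ be the vector with entry $1$ at each non-terminal node and $v_j^{-1}$ at each terminal node $j$; the limiting reciprocal value vector is $u=\lim_{s\to\infty}M^su_0$ (it exists and is strictly positive), and the limiting values are $v_i=u_i^{-1}$ (which agree with the pre-assigned values at terminal nodes). Limiting strategies. At each visit to a non-terminal node $i$, the Chooser moves to $j$ with $i\to j$ with probability $p_{i,j}=1$ if $n_i=1$ and $p_{i,j}=u_j/\sum_{k:\,i\to k}u_k$ if $n_i\ge2$ ($p_{i,j}=0$ if not $i\to j$). For terminal $i$ set $p_{i,i}=1$. With $p_{i,\min}=\min\{p_{i,j}:i\to j\}$ and a parameter $\beta\in(0,1]$, the Guesser at node $i$ guesses $j$ (with $i\to j$) with probability $q_{i,j}=1$ if $n_i=1$ and $q_{i,j}=(p_{i,j}-\beta p_{i,\min})/(1-n_i\beta p_{i,\min})$ if $n_i\ge2$, and wagers the proportion $w_i=1$ if $n_i=1$ and $w_i=1-n_i\beta p_{i,\min}$ if $n_i\ge2$; if $1-n_i\beta p_{i,\min}=0$, so $w_i=0$, the guessing distribution at $i$ is arbitrary. All guesses and choices at different times are made independently given the positions. *)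

theory Defs
  imports "HOL-Probability.Probability"
begin

text \<open>A digraph has node set \<^term>\<open>UNIV :: 'v::finite set\<close> and is given by its edge relation, so that
  there is at most one edge from \<open>i\<close> to \<open>j\<close> and loops are allowed.\<close>

definition out_degree :: "('v \<times> 'v) set \<Rightarrow> 'v \<Rightarrow> nat" where
  "out_degree E i = card (E `` {i})"

definition terminal :: "('v \<times> 'v) set \<Rightarrow> 'v \<Rightarrow> bool" where
  "terminal E i \<longleftrightarrow> out_degree E i = 0"

text \<open>Connectedness is that of the underlying undirected graph.\<close>

definition connected_digraph :: "('v \<times> 'v) set \<Rightarrow> bool" where
  "connected_digraph E \<longleftrightarrow> (\<forall>i j. (i, j) \<in> (E \<union> E\<inverse>)\<^sup>*)"

definition terminating_graph :: "('v \<times> 'v) set \<Rightarrow> bool" where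
  "terminating_graph E \<longleftrightarrow>
     connected_digraph E \<and>
     (\<forall>i. \<not> terminal E i \<longrightarrow> (\<exists>j. terminal E j \<and> (i, j) \<in> E\<^sup>*))"

definition propagation_matrix :: "('v::finite \<times> 'v) set \<Rightarrow> real^'v^'v" where
  "propagation_matrix E = (\<chi> i j.
     if terminal E i then (if i = j then 1 else 0)
     else if (i, j) \<in> E then (if out_degree E i = 1 then 1 / 2 else 1 / real (out_degree E i))
     else 0)"

text \<open>Throughout, \<open>val\<close> holds the pre-assigned values; only its entries at terminal nodes are used.\<close>

definition initial_reciprocal :: "('v::finite \<times> 'v) set \<Rightarrow> ('v \<Rightarrow> real) \<Rightarrow> real^'v" where
  "initial_reciprocal E val = (\<chi> i. if terminal E i then inverse (val i) else 1)"

text \<open>The power \<open>^\<close> on \<^typ>\<open>real^'v^'v\<close> is entrywise, so \<open>M\<^sup>s u\<^sub>0\<close> is written as an iterated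
  matrix-vector product.\<close>

definition limiting_reciprocal :: "('v::finite \<times> 'v) set \<Rightarrow> ('v \<Rightarrow> real) \<Rightarrow> real^'v" where
  "limiting_reciprocal E val =
     lim (\<lambda>s. (((*v) (propagation_matrix E)) ^^ s) (initial_reciprocal E val))"

definition limiting_value :: "('v::finite \<times> 'v) set \<Rightarrow> ('v \<Rightarrow> real) \<Rightarrow> real^'v" where
  "limiting_value E val = (\<chi> i. inverse (limiting_reciprocal E val $ i))"

definition diag :: "real^'v \<Rightarrow> real^'v^'v" where
  "diag a = (\<chi> i j. if i = j then a $ i else 0)"

definition chooser_matrix :: "('v::finite \<times> 'v) set \<Rightarrow> ('v \<Rightarrow> real) \<Rightarrow> real^'v^'v" where
  "chooser_matrix E val = (\<chi> i j.
     if terminal E i then (if i = j then 1 else 0)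
     else if (i, j) \<in> E then
       (if out_degree E i = 1 then 1
        else limiting_reciprocal E val $ j / (\<Sum>k\<in>E `` {i}. limiting_reciprocal E val $ k))
     else 0)"

definition chooser_min :: "('v::finite \<times> 'v) set \<Rightarrow> ('v \<Rightarrow> real) \<Rightarrow> 'v \<Rightarrow> real" where
  "chooser_min E val i = Min ((\<lambda>j. chooser_matrix E val $ i $ j) ` (E `` {i}))"

text \<open>Meaningful at non-terminal \<open>i\<close> only.\<close>

definition limiting_wager :: "('v::finite \<times> 'v) set \<Rightarrow> ('v \<Rightarrow> real) \<Rightarrow> real \<Rightarrow> 'v \<Rightarrow> real" where
  "limiting_wager E val \<beta> i =
     (if out_degree E i = 1 then 1 else 1 - real (out_degree E i) * \<beta> * chooser_min E val i)"

text \<open>The Guesser's guessing distributions are not determined by the parameter \<open>\<beta>\<close>: where the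
  wager is \<open>0\<close>, any distribution on the out-neighbours may be used.  Hence a predicate.\<close>

definition limiting_guesses ::
    "('v::finite \<times> 'v) set \<Rightarrow> ('v \<Rightarrow> real) \<Rightarrow> real \<Rightarrow> ('v \<Rightarrow> 'v \<Rightarrow> real) \<Rightarrow> bool" where
  "limiting_guesses E val \<beta> q \<longleftrightarrow>
     (\<forall>i. \<not> terminal E i \<longrightarrow>
        (\<forall>j. (i, j) \<notin> E \<longrightarrow> q i j = 0) \<and>
        (if out_degree E i = 1 then \<forall>j\<in>E `` {i}. q i j = 1
         else if limiting_wager E val \<beta> i = 0 then
           (\<forall>j\<in>E `` {i}. 0 \<le> q i j) \<and> (\<Sum>j\<in>E `` {i}. q i j) = 1
         else
           \<forall>j\<in>E `` {i}. q i j =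
             (chooser_matrix E val $ i $ j - \<beta> * chooser_min E val i) /
             (1 - real (out_degree E i) * \<beta> * chooser_min E val i)))"

text \<open>A play of the game when the Chooser moves from \<open>i\<close> to \<open>j\<close> with probability \<open>p i j\<close> and the
  Guesser at \<open>i\<close> guesses \<open>j\<close> with probability \<open>q i j\<close>: \<open>X t\<close> is the position at time \<open>t\<close> and \<open>G t\<close>
  the guess made there.  Given the positions up to time \<open>t\<close> and the guesses before time \<open>t\<close>, the next
  position and the current guess are independent with laws \<open>p (X t)\<close> and \<open>q (X t)\<close>.  The law of
  \<open>X 0\<close> is arbitrary, and nothing is required once a terminal node has been reached, since the game
  is then over.\<close>

locale path_guessing_play = prob_space \<Omega>
  for E :: "('v::finite \<times> 'v) set" and p q :: "'v \<Rightarrow> 'v \<Rightarrow> real"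
    and \<Omega> :: "'w measure" and X G :: "nat \<Rightarrow> 'w \<Rightarrow> 'v" +
  assumes position_measurable: "\<And>t. X t \<in> measurable \<Omega> (count_space UNIV)"
    and guess_measurable: "\<And>t. G t \<in> measurable \<Omega> (count_space UNIV)"
    and step: "\<And>t x g. \<not> terminal E (x t) \<Longrightarrow>
      prob {\<omega> \<in> space \<Omega>. (\<forall>s\<le>Suc t. X s \<omega> = x s) \<and> (\<forall>s\<le>t. G s \<omega> = g s)} =
      prob {\<omega> \<in> space \<Omega>. (\<forall>s\<le>t. X s \<omega> = x s) \<and> (\<forall>s<t. G s \<omega> = g s)}
        * p (x t) (x (Suc t)) * q (x t) (g t)"

text \<open>The following functions are evaluated along a path \<open>x\<close> of positions and a sequence \<open>g\<close> of
  guesses; \<open>w i\<close> is the proportion wagered at \<open>i\<close>.\<close>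

definition fortune_factor :: "('v \<times> 'v) set \<Rightarrow> ('v \<Rightarrow> real) \<Rightarrow> 'v \<Rightarrow> 'v \<Rightarrow> 'v \<Rightarrow> real" where
  "fortune_factor E w i guess j =
     (if out_degree E i = 1 then 1 + w i
      else if guess = j then 1 + (real (out_degree E i) - 1) * w i
      else 1 - w i)"

definition fortune ::
    "('v \<times> 'v) set \<Rightarrow> ('v \<Rightarrow> real) \<Rightarrow> (nat \<Rightarrow> 'v) \<Rightarrow> (nat \<Rightarrow> 'v) \<Rightarrow> nat \<Rightarrow> real" where
  "fortune E w x g t = (\<Prod>s<t. fortune_factor E w (x s) (g s) (x (Suc s)))"

definition duration :: "('v \<times> 'v) set \<Rightarrow> (nat \<Rightarrow> 'v) \<Rightarrow> enat" where
  "duration E x = Inf (enat ` {t. terminal E (x t)})"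

text \<open>The value \<open>0\<close> for a game that never ends is a convention.\<close>

definition final_fortune ::
    "('v \<times> 'v) set \<Rightarrow> ('v \<Rightarrow> real) \<Rightarrow> ('v \<Rightarrow> real) \<Rightarrow> (nat \<Rightarrow> 'v) \<Rightarrow> (nat \<Rightarrow> 'v) \<Rightarrow> real" where
  "final_fortune E val w x g =
     (case duration E x of enat T \<Rightarrow> fortune E w x g T * val (x T) | \<infinity> \<Rightarrow> 0)"

end

theory Submission imports Defs begin

text \<open>Split the initial vector as \<open>u\<^sub>0 = n + b\<close> with \<open>n\<close> the indicator of the non-terminal nodes.  The
  iterates of \<open>b\<close> under \<open>M\<close> increase, and those of \<open>n\<close> decrease to \<open>0\<close> by the maximum principle, so
  the limit \<open>u\<close> exists and \<open>M u = u\<close>, which gives \<open>P = V M V\<^sup>-\<^sup>1\<close>.  Averaged over the guess, the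
  fortune is multiplied by \<open>u\<^sub>j / u\<^sub>i\<close> on a move from \<open>i\<close> to \<open>j\<close>, whatever \<open>\<beta>\<close>.  These factors
  telescope, so even conditionally on the path the expected final fortune is the value of the starting
  node; summing over the possible durations, no uniform integrability is needed.  The duration is
  almost surely finite because the iterates of \<open>n\<close> under \<open>P\<close> tend to \<open>0\<close> as well.\<close>

section \<open>Iterates of absorbing matrices\<close>

text \<open>Row sums may fall short of 1, so that one notion covers both the stochastic chooser
  matrix and the propagation matrix, which loses mass where the out-degree is 1. Positivity on edges
  drives the maximum principle.\<close>

definition absorbing :: "('v::finite \<times> 'v) set \<Rightarrow> real^'v^'v \<Rightarrow> bool" where
  "absorbing E A \<longleftrightarrow>
     (\<forall>i j. 0 \<le> A $ i $ j) \<and> (\<forall>i. (\<Sum>j\<in>UNIV. A $ i $ j) \<le> 1) \<and>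
     (\<forall>i j. terminal E i \<longrightarrow> A $ i $ j = (if i = j then 1 else 0)) \<and>
     (\<forall>i j. (i, j) \<in> E \<longrightarrow> 0 < A $ i $ j)"

definition nonterminal_indicator :: "('v::finite \<times> 'v) set \<Rightarrow> real^'v" where
  "nonterminal_indicator E = (\<chi> i. if terminal E i then 0 else 1)"

lemma terminal_iff: "terminal E (i::'v::finite) \<longleftrightarrow> E `` {i} = {}"
  by (simp add: terminal_def out_degree_def)

lemma edge_not_terminal: "(i, j) \<in> E \<Longrightarrow> \<not> terminal E (i::'v::finite)"
  by (auto simp: terminal_iff)

lemma path_to_terminal:
  fixes i :: "'v::finite"
  assumes "terminating_graph E"
  obtains j where "terminal E j" "(i, j) \<in> E\<^sup>*"
  using assms unfolding terminating_graph_def by (cases "terminal E i") auto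

lemma absorbing_terminal:
  assumes "absorbing E A" "terminal E i"
  shows "(A *v x) $ i = x $ i"
proof -
  have "A $ i $ j = (if i = j then 1 else 0)" for j
    using assms by (auto simp: absorbing_def)
  then show ?thesis
    by (simp add: matrix_vector_mult_def if_distrib[of "\<lambda>c. c * _"] cong: if_cong)
qed

lemma matrix_vector_mult_minus_right: "A *v (- x) = - (A *v (x :: real^'n))"
  by (rule linear_neg[OF matrix_vector_mul_linear])

lemma nonneg_matrix_mono:
  fixes A :: "real^'n^'m"
  assumes "\<And>i j. 0 \<le> A $ i $ j" "\<And>i. x $ i \<le> y $ i"
  shows "(A *v x) $ i \<le> (A *v y) $ i"
  by (simp add: matrix_vector_mult_def assms sum_mono mult_left_mono)

text \<open>Since rows may sum to less than 1, an upper bound is sure to survive multiplication by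
  \<open>A\<close> only when it is nonnegative.\<close>

lemma absorbing_le_const:
  assumes "absorbing E A" "0 \<le> C" "\<And>i. x $ i \<le> C"
  shows "(A *v x) $ i \<le> C"
proof -
  have "(A *v x) $ i \<le> (\<Sum>j\<in>UNIV. A $ i $ j * C)"
    using assms by (auto simp: matrix_vector_mult_def absorbing_def intro!: sum_mono mult_left_mono)
  also have "\<dots> \<le> 1 * C"
    unfolding sum_distrib_right[symmetric] using assms
    by (intro mult_right_mono) (auto simp: absorbing_def)
  finally show ?thesis by simp
qed

text \<open>A nonnegative matrix preserves the componentwise order, so a single inequality between
  \<open>x\<close> and \<open>A *v x\<close> makes all coordinates of the iterates increase.
  Boundedness gives the limit, and continuity makes it a fixed point.\<close>

lemma increasing_iterates_converge:
  fixes A :: "real^'n^'n"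
  assumes nonneg: "\<And>i j. 0 \<le> A $ i $ j"
    and incr: "\<And>i. x $ i \<le> (A *v x) $ i"
    and bound: "\<And>s i. (((*v) A) ^^ s) x $ i \<le> C"
  obtains L where "(\<lambda>s. (((*v) A) ^^ s) x) \<longlonglongrightarrow> L" "A *v L = L" "\<And>s i. (((*v) A) ^^ s) x $ i \<le> L $ i"
proof -
  define f where "f s = (((*v) A) ^^ s) x" for s
  have step: "f s $ i \<le> f (Suc s) $ i" for s i
  proof (induction s arbitrary: i)
    case 0
    show ?case using incr by (simp add: f_def)
  next
    case (Suc s)
    then show ?case using nonneg_matrix_mono[OF nonneg, of "f s" "f (Suc s)"]
      by (simp add: f_def)
  qed
  then have inc: "incseq (\<lambda>s. f s $ i)" for i by (intro incseq_SucI)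
  have "\<exists>l. (\<lambda>s. f s $ i) \<longlonglongrightarrow> l" for i
    by (rule incseq_convergent[OF inc[of i], of C]) (use bound in \<open>auto simp: f_def\<close>)
  then obtain l where l: "\<And>i. (\<lambda>s. f s $ i) \<longlonglongrightarrow> l i" by metis
  define L where "L = (\<chi> i. l i)"
  have lim: "f \<longlonglongrightarrow> L" by (rule vec_tendstoI) (simp add: L_def l)
  have "(\<lambda>s. A *v f s) \<longlonglongrightarrow> A *v L"
    by (intro vec_tendstoI) (auto simp: matrix_vector_mult_def L_def intro!: tendsto_intros l)
  moreover have "(\<lambda>s. A *v f s) \<longlonglongrightarrow> L"
    using LIMSEQ_Suc[OF lim] by (simp add: f_def)
  ultimately have "A *v L = L" by (rule LIMSEQ_unique)
  moreover have "f s $ i \<le> L $ i" for s i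
    using incseq_le[OF inc l] by (simp add: L_def)
  ultimately show ?thesis using that lim unfolding f_def by blast
qed

text \<open>Maximum principle: a maximum at a non-terminal node propagates along edges to a terminal node.\<close>

lemma absorbing_fixpoint_le_0:
  fixes E :: "('v::finite \<times> 'v) set"
  assumes graph: "terminating_graph E" and A: "absorbing E A"
    and fix_x: "A *v x = x" and term_x: "\<And>i. terminal E i \<Longrightarrow> x $ i = 0"
  shows "x $ i \<le> 0"
proof (rule ccontr)
  assume "\<not> x $ i \<le> 0"
  define m where "m = Max (range (($) x))"
  have le: "x $ j \<le> m" for j unfolding m_def by (rule Max_ge) auto
  \<comment> \<open>A positive maximum is what allows row sums, which are at most 1, to be replaced
    by 1 below.\<close>
  have pos: "0 < m" using le[of i] \<open>\<not> x $ i \<le> 0\<close> by linarith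
  have "m \<in> range (($) x)" unfolding m_def by (rule Max_in) auto
  then obtain a where a: "x $ a = m" by auto
  have propagate: "x $ k = m" if "x $ j = m" and jk: "(j, k) \<in> E" for j k
  proof (rule ccontr)
    assume "x $ k \<noteq> m"
    then have "x $ k < m" using le[of k] by simp
    have "x $ j = (\<Sum>l\<in>UNIV. A $ j $ l * x $ l)"
      using arg_cong[OF fix_x, of "\<lambda>y. y $ j"] by (simp add: matrix_vector_mult_def)
    also have "\<dots> < (\<Sum>l\<in>UNIV. A $ j $ l * m)"
    proof (rule sum_strict_mono_ex1)
      show "\<forall>l\<in>UNIV. A $ j $ l * x $ l \<le> A $ j $ l * m"
        using A le by (auto simp: absorbing_def mult_left_mono)
      show "\<exists>l\<in>UNIV. A $ j $ l * x $ l < A $ j $ l * m"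
        using A jk \<open>x $ k < m\<close> by (intro bexI[of _ k]) (auto simp: absorbing_def)
    qed simp
    also have "\<dots> \<le> 1 * m"
      unfolding sum_distrib_right[symmetric] using A pos
      by (intro mult_right_mono) (auto simp: absorbing_def)
    finally show False using that by simp
  qed
  obtain b where b: "terminal E b" "(a, b) \<in> E\<^sup>*" by (rule path_to_terminal[OF graph])
  from b(2) have "x $ b = m" by (induction rule: rtrancl_induct) (use a propagate in blast)+
  then show False using term_x[OF b(1)] pos by simp
qed

text \<open>One multiplication keeps 0 at terminal nodes and gives at most 1 elsewhere, so the
  iterates decrease; they are negated to fit the lemma on increasing iterates. The limit is a fixed
  point vanishing at terminal nodes, and the maximum principle, applied to it and to its negative,
  makes it 0.\<close>

lemma absorbing_nonterminal_tendsto_0: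
  fixes E :: "('v::finite \<times> 'v) set"
  assumes graph: "terminating_graph E" and A: "absorbing E A"
  shows "(\<lambda>s. (((*v) A) ^^ s) (nonterminal_indicator E)) \<longlonglongrightarrow> 0"
proof -
  let ?n = "nonterminal_indicator E"
  have nonneg: "\<And>i j. 0 \<le> A $ i $ j" using A by (simp add: absorbing_def)
  have decr: "(- ?n) $ i \<le> (A *v - ?n) $ i" for i
  proof (cases "terminal E i")
    case True
    then show ?thesis using absorbing_terminal[OF A] by simp
  next
    case False
    have "(A *v ?n) $ i \<le> 1"
      by (rule absorbing_le_const[OF A]) (auto simp: nonterminal_indicator_def)
    then show ?thesis using False by (simp add: matrix_vector_mult_minus_right nonterminal_indicator_def)
  qed
  have bound: "(((*v) A) ^^ s) (- ?n) $ i \<le> 0" for s i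
  proof (induction s arbitrary: i)
    case 0
    show ?case by (simp add: nonterminal_indicator_def)
  next
    case (Suc s)
    show ?case using absorbing_le_const[OF A order_refl Suc] by simp
  qed
  have neg: "(((*v) A) ^^ s) (- ?n) = - (((*v) A) ^^ s) ?n" for s
    by (induction s) (auto simp: matrix_vector_mult_minus_right)
  obtain L where L: "(\<lambda>s. (((*v) A) ^^ s) (- ?n)) \<longlonglongrightarrow> L" "A *v L = L"
    by (rule increasing_iterates_converge[OF nonneg decr bound]) blast
  have "(((*v) A) ^^ s) (- ?n) $ i = 0" if "terminal E i" for s i
    by (induction s) (use that absorbing_terminal[OF A that] in \<open>auto simp: nonterminal_indicator_def\<close>)
  then have term0: "L $ i = 0" if "terminal E i" for i
    using that tendsto_vec_nth[OF L(1), of i] by (simp add: LIMSEQ_const_iff)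
  have "L $ i \<le> 0" for i by (rule absorbing_fixpoint_le_0[OF graph A L(2) term0])
  moreover have "(- L) $ i \<le> 0" for i
    by (rule absorbing_fixpoint_le_0[OF graph A]) (simp_all add: matrix_vector_mult_minus_right L(2) term0)
  ultimately have "L = 0" by (auto simp: vec_eq_iff intro: order_antisym)
  then show ?thesis using tendsto_minus[OF L(1)] by (simp add: neg)
qed

section \<open>The propagation matrix and the limiting reciprocal values\<close>

lemma propagation_matrix_absorbing: "absorbing E (propagation_matrix E)"
proof -
  have "(\<Sum>j\<in>UNIV. propagation_matrix E $ i $ j) \<le> 1" for i
  proof (cases "terminal E i")
    case True
    then show ?thesis by (simp add: propagation_matrix_def)
  next
    case False
    have "(\<Sum>j\<in>UNIV. propagation_matrix E $ i $ j) = (\<Sum>j\<in>E `` {i}. propagation_matrix E $ i $ j)"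
      by (rule sum.mono_neutral_right) (use False in \<open>auto simp: propagation_matrix_def\<close>)
    also have "\<dots> = (\<Sum>j\<in>E `` {i}. if out_degree E i = 1 then 1 / 2 else 1 / real (out_degree E i))"
      using False by (intro sum.cong) (auto simp: propagation_matrix_def)
    also have "\<dots> \<le> 1" by (simp add: out_degree_def)
    finally show ?thesis .
  qed
  moreover have "0 < propagation_matrix E $ i $ j" if "(i, j) \<in> E" for i j
    using that edge_not_terminal[OF that] by (simp add: propagation_matrix_def terminal_def)
  moreover have "0 \<le> propagation_matrix E $ i $ j" for i j
    by (simp add: propagation_matrix_def)
  ultimately show ?thesis
    by (simp add: absorbing_def propagation_matrix_def)
qed

text \<open>Positivity starts at the terminal nodes, where \<open>u\<close> keeps its initial
  entries, and spreads backwards along edges because \<open>u $ j\<close> is at least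
  \<open>M $ j $ k * u $ k\<close>. Every node has a path to a terminal one.\<close>

lemma limiting_reciprocal_fixpoint:
  fixes E :: "('v::finite \<times> 'v) set"
  assumes graph: "terminating_graph E" and val: "\<And>j. terminal E j \<Longrightarrow> 0 < val j"
  defines "M \<equiv> propagation_matrix E" and "u \<equiv> limiting_reciprocal E val"
  shows "M *v u = u" and "\<And>i. 0 < u $ i" and "\<And>i. terminal E i \<Longrightarrow> u $ i = inverse (val i)"
proof -
  have A: "absorbing E M" unfolding M_def by (rule propagation_matrix_absorbing)
  have nonneg: "\<And>i j. 0 \<le> M $ i $ j" using A by (simp add: absorbing_def)
  \<comment> \<open>The part of the initial vector supported on terminal nodes, which alone
    determines the limit. Its iterates increase because \<open>M\<close> fixes terminal entries and
    is nonnegative.\<close>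
  define b where "b = (\<chi> i. if terminal E i then inverse (val i) else 0)"
  have b0: "0 \<le> b $ i" for i using val[of i] by (simp add: b_def less_imp_le)
  have incr: "b $ i \<le> (M *v b) $ i" for i
  proof (cases "terminal E i")
    case True
    then show ?thesis using absorbing_terminal[OF A] by simp
  next
    case False
    have "0 \<le> (M *v b) $ i"
      using nonneg b0 by (simp add: matrix_vector_mult_def sum_nonneg)
    then show ?thesis using False by (simp add: b_def)
  qed
  define C where "C = Max (range (($) b))"
  have bC: "b $ j \<le> C" for j unfolding C_def by (rule Max_ge) auto
  have C0: "0 \<le> C" using b0 bC order_trans by blast
  have bound: "(((*v) M) ^^ s) b $ i \<le> C" for s i
    by (induction s arbitrary: i) (auto intro: bC absorbing_le_const[OF A C0])
  obtain L where L: "(\<lambda>s. (((*v) M) ^^ s) b) \<longlonglongrightarrow> L" "M *v L = L"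
    "\<And>s i. (((*v) M) ^^ s) b $ i \<le> L $ i"
    by (rule increasing_iterates_converge[OF nonneg incr bound]) blast
  have init: "initial_reciprocal E val = nonterminal_indicator E + b"
    by (simp add: initial_reciprocal_def nonterminal_indicator_def b_def vec_eq_iff)
  have split: "(((*v) M) ^^ s) (x + y) = (((*v) M) ^^ s) x + (((*v) M) ^^ s) y" for s x y
    by (induction s) (auto simp: matrix_vector_right_distrib)
  have lim: "(\<lambda>s. (((*v) M) ^^ s) (initial_reciprocal E val)) \<longlonglongrightarrow> L"
    unfolding init split
    using tendsto_add[OF absorbing_nonterminal_tendsto_0[OF graph A] L(1)] by simp
  then have u: "u = L" unfolding u_def limiting_reciprocal_def M_def by (rule limI)
  show fix_u: "M *v u = u" using L(2) u by simp
  \<comment> \<open>The limit dominates every iterate, in particular \<open>b\<close> itself at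
    \<open>s = 0\<close>.\<close>
  have u0: "0 \<le> u $ i" for i using L(3)[of 0 i] b0[of i] by (simp add: u)
  have "(((*v) M) ^^ s) b $ i = b $ i" if "terminal E i" for s i
    by (induction s) (use absorbing_terminal[OF A that] in auto)
  then show term_u: "u $ i = inverse (val i)" if "terminal E i" for i
    using that tendsto_vec_nth[OF L(1), of i] by (simp add: LIMSEQ_const_iff u b_def)
  have backward: "0 < u $ j" if "(j, k) \<in> E" "0 < u $ k" for j k
  proof -
    have "0 < M $ j $ k * u $ k" using that A by (simp add: absorbing_def)
    also have "\<dots> \<le> (\<Sum>l\<in>UNIV. M $ j $ l * u $ l)"
      by (rule member_le_sum) (auto simp: nonneg u0)
    also have "\<dots> = u $ j"
      using arg_cong[OF fix_u, of "\<lambda>y. y $ j"] by (simp add: matrix_vector_mult_def)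
    finally show ?thesis .
  qed
  show "0 < u $ i" for i
  proof -
    obtain j where j: "terminal E j" "(i, j) \<in> E\<^sup>*" by (rule path_to_terminal[OF graph])
    from j(2) show ?thesis
      by (induction rule: converse_rtrancl_induct) (auto simp: term_u[OF j(1)] val j(1) intro: backward)
  qed
qed


section \<open>The limiting strategies\<close>

text \<open>The nonzero entries in a nonterminal row of the propagation matrix share one value
  \<open>c\<close>, so the fixed-point equation says that \<open>u $ i\<close> is \<open>c\<close>
  times the sum of \<open>u\<close> over the out-neighbours. In the quotient \<open>c\<close>
  cancels, including the 1/2 at out-degree 1.\<close>

lemma chooser_matrix_eq:
  fixes E :: "('v::finite \<times> 'v) set"
  assumes graph: "terminating_graph E" and val: "\<And>j. terminal E j \<Longrightarrow> 0 < val j"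
  defines "u \<equiv> limiting_reciprocal E val"
  shows "chooser_matrix E val $ i $ j = propagation_matrix E $ i $ j * u $ j / u $ i"
proof (cases "terminal E i \<or> (i, j) \<notin> E")
  case True
  have "0 < u $ i" unfolding u_def by (rule limiting_reciprocal_fixpoint[OF graph val])
  then show ?thesis using True by (auto simp: chooser_matrix_def propagation_matrix_def)
next
  case False
  let ?n = "out_degree E i"
  define c where "c = (if ?n = 1 then 1 / 2 else 1 / real ?n)"
  have pos: "0 < u $ k" for k unfolding u_def by (rule limiting_reciprocal_fixpoint[OF graph val])
  have "u $ i = (\<Sum>k\<in>UNIV. propagation_matrix E $ i $ k * u $ k)"
    using arg_cong[OF limiting_reciprocal_fixpoint(1)[where val=val, OF graph val], of "\<lambda>y. y $ i"]
    by (simp add: matrix_vector_mult_def u_def)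
  also have "\<dots> = (\<Sum>k\<in>E `` {i}. propagation_matrix E $ i $ k * u $ k)"
    by (rule sum.mono_neutral_right) (use False in \<open>auto simp: propagation_matrix_def\<close>)
  also have "\<dots> = (\<Sum>k\<in>E `` {i}. c * u $ k)"
    using False by (intro sum.cong) (auto simp: propagation_matrix_def c_def)
  finally have ui: "u $ i = c * (\<Sum>k\<in>E `` {i}. u $ k)" by (simp add: sum_distrib_left)
  have "0 < ?n" using False by (simp add: terminal_def)
  then have c: "0 < c" by (simp add: c_def)
  show ?thesis
  proof (cases "?n = 1")
    case True
    then obtain k where "E `` {i} = {k}" by (auto simp: out_degree_def card_1_singleton_iff)
    moreover from this have "j = k" using False by blast
    ultimately have "u $ i = c * u $ j" using ui by simp
    then show ?thesis using False True pos[of j] pos[of i]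
      by (simp add: chooser_matrix_def propagation_matrix_def c_def)
  next
    case False': False
    then have "chooser_matrix E val $ i $ j = u $ j / (\<Sum>k\<in>E `` {i}. u $ k)"
      using False by (simp add: chooser_matrix_def u_def)
    moreover have "propagation_matrix E $ i $ j = c"
      using False False' by (simp add: propagation_matrix_def c_def)
    ultimately show ?thesis using ui c by simp
  qed
qed

lemma matrix_inv_diag:
  assumes "\<And>i. a $ i \<noteq> 0"
  shows "matrix_inv (diag a) = diag (\<chi> i. inverse (a $ i))"
proof -
  let ?b = "\<chi> i. inverse (a $ i)"
  have right: "diag a ** diag ?b = mat 1"
    using assms by (auto simp: diag_def matrix_matrix_mult_def mat_def vec_eq_iff
        if_distrib[of "\<lambda>c. c * _"] cong: if_cong)
  have left: "diag ?b ** diag a = mat 1"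
    using assms by (auto simp: diag_def matrix_matrix_mult_def mat_def vec_eq_iff
        if_distrib[of "\<lambda>c. c * _"] cong: if_cong)
  \<comment> \<open>\<open>matrix_inv\<close> is a choice operator: the witness
    \<open>diag ?b\<close> shows that the chosen matrix is an inverse, and multiplying by
    \<open>diag ?b\<close> on the right then identifies it.\<close>
  have "matrix_inv (diag a) ** diag a = mat 1"
    unfolding matrix_inv_def by (rule someI2[of _ "diag ?b"]) (use left right in auto)
  then have "matrix_inv (diag a) ** (diag a ** diag ?b) = diag ?b"
    by (simp add: matrix_mul_assoc)
  then show ?thesis by (simp add: right)
qed

lemma diag_conjugate_nth: "(diag a ** A ** diag b) $ i $ j = a $ i * A $ i $ j * b $ j"
  by (simp add: diag_def matrix_matrix_mult_def if_distrib[of "\<lambda>c. c * _"]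
      if_distrib[of "\<lambda>c. _ * c"] cong: if_cong)

lemma chooser_matrix_conjugate:
  fixes E :: "('v::finite \<times> 'v) set"
  assumes graph: "terminating_graph E" and val: "\<And>j. terminal E j \<Longrightarrow> 0 < val j"
  shows "chooser_matrix E val =
    diag (limiting_value E val) ** propagation_matrix E ** matrix_inv (diag (limiting_value E val))"
proof -
  have pos: "0 < limiting_reciprocal E val $ k" for k
    by (rule limiting_reciprocal_fixpoint[OF graph val])
  have "limiting_value E val $ k \<noteq> 0" for k using pos[of k] by (simp add: limiting_value_def)
  then show ?thesis
    by (simp add: vec_eq_iff matrix_inv_diag diag_conjugate_nth chooser_matrix_eq[OF graph val]
        limiting_value_def field_simps)
qed

text \<open>Row \<open>i\<close> sums to the \<open>i\<close>-th entry of the propagated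
  \<open>u\<close> divided by \<open>u $ i\<close>, so stochasticity is the fixed-point equation in
  disguise.\<close>

lemma chooser_matrix_row_sum:
  fixes E :: "('v::finite \<times> 'v) set"
  assumes graph: "terminating_graph E" and val: "\<And>j. terminal E j \<Longrightarrow> 0 < val j"
  shows "(\<Sum>j\<in>UNIV. chooser_matrix E val $ i $ j) = 1"
proof -
  let ?u = "limiting_reciprocal E val"
  have "(\<Sum>j\<in>UNIV. propagation_matrix E $ i $ j * ?u $ j) = ?u $ i"
    using arg_cong[OF limiting_reciprocal_fixpoint(1)[where val=val, OF graph val], of "\<lambda>y. y $ i"]
    by (simp add: matrix_vector_mult_def)
  moreover have "0 < ?u $ i" by (rule limiting_reciprocal_fixpoint[OF graph val])
  ultimately show ?thesis
    by (simp add: chooser_matrix_eq[OF graph val] sum_divide_distrib[symmetric])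
qed

lemma chooser_matrix_absorbing:
  fixes E :: "('v::finite \<times> 'v) set"
  assumes graph: "terminating_graph E" and val: "\<And>j. terminal E j \<Longrightarrow> 0 < val j"
  shows "absorbing E (chooser_matrix E val)"
proof -
  have pos: "0 < limiting_reciprocal E val $ k" for k
    by (rule limiting_reciprocal_fixpoint[OF graph val])
  have M: "absorbing E (propagation_matrix E)" by (rule propagation_matrix_absorbing)
  have "0 \<le> chooser_matrix E val $ i $ j" for i j
    using M pos by (simp add: chooser_matrix_eq[OF graph val] absorbing_def less_imp_le)
  moreover have "0 < chooser_matrix E val $ i $ j" if "(i, j) \<in> E" for i j
    using M pos that by (simp add: chooser_matrix_eq[OF graph val] absorbing_def)
  ultimately show ?thesis
    by (simp add: absorbing_def chooser_matrix_row_sum[OF graph val]) (simp add: chooser_matrix_def)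
qed

section \<open>The Guesser's wagers and guesses, and the mean fortune factor\<close>

context
  fixes E :: "('v::finite \<times> 'v) set" and val :: "'v \<Rightarrow> real" and \<beta> :: real and q :: "'v \<Rightarrow> 'v \<Rightarrow> real"
  assumes graph: "terminating_graph E" and val: "\<And>j. terminal E j \<Longrightarrow> 0 < val j"
    and \<beta>: "0 < \<beta>" "\<beta> \<le> 1" and q: "limiting_guesses E val \<beta> q"
begin

lemma chooser_matrix_edge_sum:
  assumes "\<not> terminal E i"
  shows "(\<Sum>j\<in>E `` {i}. chooser_matrix E val $ i $ j) = 1"
proof -
  have "(\<Sum>j\<in>E `` {i}. chooser_matrix E val $ i $ j) = (\<Sum>j\<in>UNIV. chooser_matrix E val $ i $ j)"
    by (rule sum.mono_neutral_left) (use assms in \<open>auto simp: chooser_matrix_def\<close>)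
  then show ?thesis by (simp add: chooser_matrix_row_sum[OF graph val])
qed

lemma chooser_min_le: "(i, j) \<in> E \<Longrightarrow> chooser_min E val i \<le> chooser_matrix E val $ i $ j"
  unfolding chooser_min_def by (rule Min_le) auto

lemma chooser_min_pos:
  assumes "\<not> terminal E i"
  shows "0 < chooser_min E val i"
  using chooser_matrix_absorbing[OF graph val] assms
  by (auto simp: chooser_min_def terminal_iff absorbing_def)

lemma scaled_chooser_min_le:
  assumes "(i, j) \<in> E"
  shows "\<beta> * chooser_min E val i \<le> chooser_matrix E val $ i $ j"
proof -
  have "\<beta> * chooser_min E val i \<le> 1 * chooser_min E val i"
    using \<beta> chooser_min_pos[OF edge_not_terminal[OF assms]] by (intro mult_right_mono) auto
  then show ?thesis using chooser_min_le[OF assms] by simp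
qed

text \<open>The summands are the unnormalised guessing weights; where the out-degree is not 1, their
  total is the wager. This gives both the sign of the wager and the normalisation of the
  guesses.\<close>

lemma sum_chooser_excess:
  assumes "\<not> terminal E i"
  shows "(\<Sum>j\<in>E `` {i}. chooser_matrix E val $ i $ j - \<beta> * chooser_min E val i) =
    1 - real (out_degree E i) * \<beta> * chooser_min E val i"
  by (simp add: sum_subtractf chooser_matrix_edge_sum[OF assms] out_degree_def)

text \<open>A wager in [0,1] keeps fortune factors nonnegative, which later permits exchanging sums
  and integrals. Away from out-degree 1 the wager is a sum of weights made nonnegative by \<beta>
  \<le> 1.\<close>

lemma limiting_wager_bounds:
  assumes "\<not> terminal E i"
  shows "0 \<le> limiting_wager E val \<beta> i" "limiting_wager E val \<beta> i \<le> 1"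
proof -
  have "0 \<le> (\<Sum>j\<in>E `` {i}. chooser_matrix E val $ i $ j - \<beta> * chooser_min E val i)"
    by (rule sum_nonneg) (auto simp: scaled_chooser_min_le)
  then show "0 \<le> limiting_wager E val \<beta> i"
    by (simp add: limiting_wager_def sum_chooser_excess[OF assms])
  show "limiting_wager E val \<beta> i \<le> 1"
    using \<beta> chooser_min_pos[OF assms] by (simp add: limiting_wager_def)
qed

text \<open>If the wager is \<open>0\<close>, all excesses on the right vanish, whatever the guessing distribution.\<close>

lemma wager_times_guess:
  assumes "(i, j) \<in> E" "out_degree E i \<noteq> 1"
  shows "limiting_wager E val \<beta> i * q i j = chooser_matrix E val $ i $ j - \<beta> * chooser_min E val i"
proof (cases "limiting_wager E val \<beta> i = 0")
  case True
  have i: "\<not> terminal E i" using assms(1) by (rule edge_not_terminal)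
  have "(\<Sum>k\<in>E `` {i}. chooser_matrix E val $ i $ k - \<beta> * chooser_min E val i) = 0"
    using True assms(2) by (simp add: limiting_wager_def sum_chooser_excess[OF i])
  then have "\<forall>k\<in>E `` {i}. chooser_matrix E val $ i $ k - \<beta> * chooser_min E val i = 0"
    by (subst (asm) sum_nonneg_eq_0_iff) (auto simp: scaled_chooser_min_le)
  then show ?thesis using True assms(1) by simp
next
  case False
  then have "q i j = (chooser_matrix E val $ i $ j - \<beta> * chooser_min E val i) / limiting_wager E val \<beta> i"
    using q assms edge_not_terminal[OF assms(1)] by (simp add: limiting_guesses_def limiting_wager_def)
  then show ?thesis using False by simp
qed

lemma guess_row_sum:
  assumes i: "\<not> terminal E i"
  shows "(\<Sum>j\<in>UNIV. q i j) = 1"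
proof -
  have "(\<Sum>j\<in>UNIV. q i j) = (\<Sum>j\<in>E `` {i}. q i j)"
    using q i by (intro sum.mono_neutral_right) (auto simp: limiting_guesses_def)
  also have "\<dots> = 1"
  proof (cases "out_degree E i = 1")
    case True
    then obtain k where "E `` {i} = {k}" by (auto simp: out_degree_def card_1_singleton_iff)
    then show ?thesis using q i True by (simp add: limiting_guesses_def)
  next
    case False
    show ?thesis
    proof (cases "limiting_wager E val \<beta> i = 0")
      case True
      then show ?thesis using q i False by (simp add: limiting_guesses_def)
    next
      case wager: False
      \<comment> \<open>Wager times guess is the excess, and the excesses sum to the wager, so a
        nonzero wager can be cancelled.\<close>
      have "limiting_wager E val \<beta> i * (\<Sum>j\<in>E `` {i}. q i j) = limiting_wager E val \<beta> i"
        using False by (simp add: sum_distrib_left wager_times_guess sum_chooser_excess[OF i])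
          (simp add: limiting_wager_def)
      then show ?thesis using wager by simp
    qed
  qed
  finally show ?thesis .
qed

text \<open>For out-degree n \<ge> 2 the mean is (1 - w) + n w q_ij. Here w q_ij is p_ij less
  \<beta> p_min, and n \<beta> p_min is 1 - w, so \<beta> drops out and n p_ij = u_j / u_i remains.
  At out-degree 1 both sides are 2.\<close>

lemma expected_fortune_factor:
  assumes edge: "(i, j) \<in> E"
  shows "(\<Sum>g\<in>UNIV. q i g * fortune_factor E (limiting_wager E val \<beta>) i g j) =
    limiting_reciprocal E val $ j / limiting_reciprocal E val $ i"
proof -
  let ?u = "limiting_reciprocal E val" and ?n = "out_degree E i" and ?w = "limiting_wager E val \<beta> i"
  have i: "\<not> terminal E i" using edge by (rule edge_not_terminal)
  have P: "chooser_matrix E val $ i $ j = propagation_matrix E $ i $ j * ?u $ j / ?u $ i"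
    by (rule chooser_matrix_eq[OF graph val])
  show ?thesis
  proof (cases "?n = 1")
    case True
    then have "chooser_matrix E val $ i $ j = 1" "propagation_matrix E $ i $ j = 1 / 2"
      using i edge by (auto simp: chooser_matrix_def propagation_matrix_def)
    then have "?u $ j / ?u $ i = 2" unfolding P by (auto simp: field_simps)
    moreover have "(\<Sum>g\<in>UNIV. q i g * fortune_factor E (limiting_wager E val \<beta>) i g j) = (\<Sum>g\<in>UNIV. q i g) * 2"
      using True by (simp add: fortune_factor_def limiting_wager_def sum_distrib_right)
    ultimately show ?thesis by (simp add: guess_row_sum[OF i])
  next
    case False
    have n: "0 < ?n" using i by (simp add: terminal_def)
    \<comment> \<open>A correct guess gains \<open>?n * ?w\<close> over a wrong one, as
      \<open>1 + (?n - 1) * ?w = (1 - ?w) + ?n * ?w\<close>.\<close>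
    have "q i g * fortune_factor E (limiting_wager E val \<beta>) i g j =
        (1 - ?w) * q i g + (if j = g then real ?n * (?w * q i g) else 0)" for g
      using False by (simp add: fortune_factor_def algebra_simps)
    then have "(\<Sum>g\<in>UNIV. q i g * fortune_factor E (limiting_wager E val \<beta>) i g j) =
        (1 - ?w) * (\<Sum>g\<in>UNIV. q i g) + real ?n * (?w * q i j)"
      by (simp add: sum.distrib sum_distrib_left)
    also have "\<dots> = real ?n * chooser_matrix E val $ i $ j"
      unfolding guess_row_sum[OF i] wager_times_guess[OF edge False] using False
      by (simp add: limiting_wager_def algebra_simps)
    also have "\<dots> = ?u $ j / ?u $ i"
      using P i edge False n by (simp add: propagation_matrix_def)
    finally show ?thesis .
  qed
qed

end


section \<open>Plays\<close>

text \<open>The strict inequality lets \<open>x t\<close> be terminal; combined with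
  \<open>terminal E (x t)\<close> it expresses that play ends exactly at \<open>t\<close>.\<close>

definition alive :: "('v \<times> 'v) set \<Rightarrow> (nat \<Rightarrow> 'v) \<Rightarrow> nat \<Rightarrow> bool" where
  "alive E x t \<longleftrightarrow> (\<forall>s<t. \<not> terminal E (x s))"

lemma alive_0 [simp]: "alive E x 0"
  by (simp add: alive_def)

lemma alive_Suc: "alive E x (Suc t) \<longleftrightarrow> alive E x t \<and> \<not> terminal E (x t)"
  by (auto simp: alive_def less_Suc_eq)

lemma alive_cong: "(\<And>s. s < t \<Longrightarrow> x s = x' s) \<Longrightarrow> alive E x t \<longleftrightarrow> alive E x' t"
  by (simp add: alive_def)

lemma duration_eq_enat_iff: "duration E x = enat t \<longleftrightarrow> alive E x t \<and> terminal E (x t)"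
proof (cases "{t. terminal E (x t)} = {}")
  case True
  \<comment> \<open>The infimum of the empty set in \<open>enat\<close> is infinity.\<close>
  then show ?thesis by (auto simp: duration_def top_enat_def)
next
  case False
  then obtain n where "terminal E (x n)" by auto
  define m where "m = (LEAST n. terminal E (x n))"
  have m: "terminal E (x m)" "\<And>k. terminal E (x k) \<Longrightarrow> m \<le> k"
    unfolding m_def by (rule LeastI, fact) (rule Least_le)
  have "duration E x = enat m"
    unfolding duration_def by (rule antisym) (auto intro!: Inf_lower Inf_greatest m)
  moreover have "alive E x t \<and> terminal E (x t) \<longleftrightarrow> m = t"
    using m unfolding alive_def by (metis leD le_neq_implies_less)
  ultimately show ?thesis by simp
qed

lemma duration_finite_iff: "duration E x < \<infinity> \<longleftrightarrow> (\<exists>t. terminal E (x t))"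
proof
  assume "duration E x < \<infinity>"
  then obtain t where "duration E x = enat t" by auto
  then show "\<exists>t. terminal E (x t)" by (auto simp: duration_eq_enat_iff)
next
  assume "\<exists>t. terminal E (x t)"
  then obtain t where "terminal E (x t)" by auto
  then have "duration E x \<le> enat t" unfolding duration_def by (intro Inf_lower) auto
  then show "duration E x < \<infinity>" by (rule le_less_trans) simp
qed

text \<open>Only the term at the duration can be nonzero. A game that never ends gives the zero
  series, in agreement with the convention in \<open>final_fortune\<close>.\<close>

lemma final_fortune_sums:
  "(\<lambda>t. of_bool (alive E x t \<and> terminal E (x t)) * fortune E w x g t * val (x t))
     sums final_fortune E val w x g"
proof (cases "duration E x")
  case (enat T)
  have "alive E x t \<and> terminal E (x t) \<longleftrightarrow> t = T" for t
    unfolding duration_eq_enat_iff[symmetric] enat by auto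
  then have "(\<lambda>t. of_bool (alive E x t \<and> terminal E (x t)) * fortune E w x g t * val (x t)) =
      (\<lambda>t. if t = T then fortune E w x g t * val (x t) else 0)"
    by auto
  then show ?thesis using enat sums_single[of T "\<lambda>t. fortune E w x g t * val (x t)"]
    by (simp add: final_fortune_def)
next
  case infinity
  have "\<not> (alive E x t \<and> terminal E (x t))" for t
    unfolding duration_eq_enat_iff[symmetric] infinity by simp
  then have "(\<lambda>t. of_bool (alive E x t \<and> terminal E (x t)) * fortune E w x g t * val (x t)) = (\<lambda>t. 0)"
    by auto
  then show ?thesis using infinity by (simp add: final_fortune_def)
qed

text \<open>Positions count up to \<open>t\<close> but guesses only before \<open>t\<close>: this is
  the information on which \<open>step\<close> conditions. The functionals act on sequences rather
  than outcomes, so they can also be evaluated at a finite history.\<close>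

definition adapted :: "nat \<Rightarrow> ((nat \<Rightarrow> 'v) \<Rightarrow> (nat \<Rightarrow> 'v) \<Rightarrow> real) \<Rightarrow> bool" where
  "adapted t f \<longleftrightarrow>
     (\<forall>x x' g g'. (\<forall>s\<le>t. x s = x' s) \<longrightarrow> (\<forall>s<t. g s = g' s) \<longrightarrow> f x g = f x' g')"

lemma adaptedD:
  "adapted t f \<Longrightarrow> (\<And>s. s \<le> t \<Longrightarrow> x s = x' s) \<Longrightarrow> (\<And>s. s < t \<Longrightarrow> g s = g' s) \<Longrightarrow> f x g = f x' g'"
  by (auto simp: adapted_def)

lemma adapted_mult: "adapted t f \<Longrightarrow> adapted t f' \<Longrightarrow> adapted t (\<lambda>x g. f x g * f' x g)"
  unfolding adapted_def by (intro allI impI arg_cong2[where f="(*)"]) blast+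

lemma adapted_at: "s \<le> t \<Longrightarrow> adapted t (\<lambda>x g. \<phi> (x s))"
  by (simp add: adapted_def)

lemma adapted_alive: "adapted t (\<lambda>x g. of_bool (alive E x t))"
  unfolding adapted_def by (intro allI impI arg_cong[where f=of_bool] alive_cong) simp

lemma adapted_fortune: "adapted t (\<lambda>x g. fortune E w x g t)"
  by (auto simp: adapted_def fortune_def intro!: prod.cong)

section \<open>Expectations along a play\<close>

context path_guessing_play
begin

lemmas [measurable] = position_measurable guess_measurable

definition cylinder :: "nat \<Rightarrow> (nat \<Rightarrow> 'v) \<Rightarrow> (nat \<Rightarrow> 'v) \<Rightarrow> 'w set" where
  "cylinder t x g = {\<omega> \<in> space \<Omega>. (\<forall>s\<le>t. X s \<omega> = x s) \<and> (\<forall>s<t. G s \<omega> = g s)}"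

lemma cylinder_measurable [measurable]: "cylinder t x g \<in> sets \<Omega>"
  unfolding cylinder_def by measurable

text \<open>Extensional functions are fixed outside their index range, so there are finitely many
  histories and each outcome lies in the cylinder of exactly one.\<close>

definition histories :: "nat \<Rightarrow> ((nat \<Rightarrow> 'v) \<times> (nat \<Rightarrow> 'v)) set" where
  "histories t = ({..t} \<rightarrow>\<^sub>E UNIV) \<times> ({..<t} \<rightarrow>\<^sub>E UNIV)"

lemma finite_histories: "finite (histories t)"
  unfolding histories_def by (intro finite_cartesian_product finite_PiE) auto

lemma cylinder_iff:
  assumes "(x, g) \<in> histories t" "\<omega> \<in> space \<Omega>"
  shows "\<omega> \<in> cylinder t x g \<longleftrightarrow> x = restrict (\<lambda>s. X s \<omega>) {..t} \<and> g = restrict (\<lambda>s. G s \<omega>) {..<t}"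
  using assms
  by (auto simp: histories_def cylinder_def fun_eq_iff PiE_iff extensional_def restrict_def)

text \<open>The cylinders of histories partition the space, and an adapted functional is constant on
  each. Expectations become finite sums and integrability is automatic.\<close>

lemma adapted_expansion:
  assumes "adapted t f" "\<omega> \<in> space \<Omega>"
  shows "f (\<lambda>s. X s \<omega>) (\<lambda>s. G s \<omega>) =
    (\<Sum>h\<in>histories t. f (fst h) (snd h) * indicator (cylinder t (fst h) (snd h)) \<omega>)"
proof -
  let ?h = "(restrict (\<lambda>s. X s \<omega>) {..t}, restrict (\<lambda>s. G s \<omega>) {..<t})"
  have "(\<Sum>h\<in>histories t. f (fst h) (snd h) * indicator (cylinder t (fst h) (snd h)) \<omega>) =
      (\<Sum>h\<in>histories t. if h = ?h then f (fst h) (snd h) else 0)"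
    by (intro sum.cong refl) (auto simp: cylinder_iff[OF _ assms(2)] split: split_indicator)
  also have "\<dots> = f (fst ?h) (snd ?h)"
    using finite_histories by (subst sum.delta) (auto simp: histories_def)
  also have "\<dots> = f (\<lambda>s. X s \<omega>) (\<lambda>s. G s \<omega>)"
    by (rule adaptedD[OF assms(1)]) auto
  finally show ?thesis by simp
qed

lemma adapted_integrable:
  assumes "adapted t f"
  shows "integrable \<Omega> (\<lambda>\<omega>. f (\<lambda>s. X s \<omega>) (\<lambda>s. G s \<omega>))"
proof -
  have "integrable \<Omega> (\<lambda>\<omega>. \<Sum>h\<in>histories t. f (fst h) (snd h) * indicator (cylinder t (fst h) (snd h)) \<omega>)"
    by (intro Bochner_Integration.integrable_sum Bochner_Integration.integrable_mult_right
        integrable_real_indicator) (auto simp: emeasure_eq_measure)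
  then show ?thesis
    by (simp add: adapted_expansion[OF assms] cong: Bochner_Integration.integrable_cong)
qed

lemma expectation_adapted:
  assumes "adapted t f"
  shows "expectation (\<lambda>\<omega>. f (\<lambda>s. X s \<omega>) (\<lambda>s. G s \<omega>)) =
    (\<Sum>h\<in>histories t. f (fst h) (snd h) * prob (cylinder t (fst h) (snd h)))"
proof -
  have "expectation (\<lambda>\<omega>. f (\<lambda>s. X s \<omega>) (\<lambda>s. G s \<omega>)) =
    expectation (\<lambda>\<omega>. \<Sum>h\<in>histories t. f (fst h) (snd h) * indicator (cylinder t (fst h) (snd h)) \<omega>)"
    using adapted_expansion[OF assms] by (intro Bochner_Integration.integral_cong) auto
  also have "\<dots> = (\<Sum>h\<in>histories t. f (fst h) (snd h) * prob (cylinder t (fst h) (snd h)))"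
    by (subst Bochner_Integration.integral_sum)
      (auto intro!: integrable_mult_right integrable_real_indicator simp: emeasure_eq_measure)
  finally show ?thesis .
qed

text \<open>The assumption \<open>step\<close> speaks of whole sequences. Overwriting
  \<open>x\<close> at \<open>Suc t\<close> and \<open>g\<close> at \<open>t\<close> turns the new
  position and guess into parameters and leaves the cylinder up to \<open>t\<close>
  unchanged.\<close>

lemma prob_cylinder_step:
  assumes "\<not> terminal E (x t)"
  shows "prob (cylinder t x g \<inter> {\<omega> \<in> space \<Omega>. G t \<omega> = b \<and> X (Suc t) \<omega> = j}) =
    prob (cylinder t x g) * p (x t) j * q (x t) b"
proof -
  have "cylinder t x g \<inter> {\<omega> \<in> space \<Omega>. G t \<omega> = b \<and> X (Suc t) \<omega> = j} =
      {\<omega> \<in> space \<Omega>. (\<forall>s\<le>Suc t. X s \<omega> = (x(Suc t := j)) s) \<and> (\<forall>s\<le>t. G s \<omega> = (g(t := b)) s)}"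
    unfolding cylinder_def by (auto simp: le_Suc_eq less_Suc_eq_le[symmetric] less_Suc_eq)
  moreover have "cylinder t x g =
      {\<omega> \<in> space \<Omega>. (\<forall>s\<le>t. X s \<omega> = (x(Suc t := j)) s) \<and> (\<forall>s<t. G s \<omega> = (g(t := b)) s)}"
    by (auto simp: cylinder_def)
  ultimately show ?thesis using step[of "x(Suc t := j)" t "g(t := b)"] assms by simp
qed

text \<open>The tower property without conditional expectations: split over histories, current
  guesses and next positions, then factor each probability. Since \<open>step\<close> says nothing
  at terminal positions, \<open>f\<close> has to vanish there.\<close>

lemma expectation_step:
  assumes f: "adapted t f" and f0: "\<And>x g. terminal E (x t) \<Longrightarrow> f x g = 0"
  shows "expectation (\<lambda>\<omega>. f (\<lambda>s. X s \<omega>) (\<lambda>s. G s \<omega>) * \<psi> (X t \<omega>) (G t \<omega>) (X (Suc t) \<omega>)) =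
    expectation (\<lambda>\<omega>. f (\<lambda>s. X s \<omega>) (\<lambda>s. G s \<omega>) *
      (\<Sum>j\<in>UNIV. \<Sum>b\<in>UNIV. p (X t \<omega>) j * q (X t \<omega>) b * \<psi> (X t \<omega>) b j))"
proof -
  define S where "S b j = {\<omega> \<in> space \<Omega>. G t \<omega> = b \<and> X (Suc t) \<omega> = j}" for b j
  have [measurable]: "S b j \<in> sets \<Omega>" for b j unfolding S_def by measurable
  have \<psi>: "\<psi> a (G t \<omega>) (X (Suc t) \<omega>) = (\<Sum>j\<in>UNIV. \<Sum>b\<in>UNIV. \<psi> a b j * indicator (S b j) \<omega>)"
    if "\<omega> \<in> space \<Omega>" for a \<omega>
  proof -
    have "(\<Sum>j\<in>UNIV. \<Sum>b\<in>UNIV. \<psi> a b j * indicator (S b j) \<omega>) =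
        (\<Sum>j\<in>UNIV. \<Sum>b\<in>UNIV. if j = X (Suc t) \<omega> then if b = G t \<omega> then \<psi> a b j else 0 else 0)"
      using that by (intro sum.cong refl) (auto simp: S_def)
    also have "\<dots> = (\<Sum>j\<in>UNIV. if j = X (Suc t) \<omega> then \<psi> a (G t \<omega>) j else 0)"
      by (intro sum.cong refl) simp
    finally show ?thesis by simp
  qed
  have "expectation (\<lambda>\<omega>. f (\<lambda>s. X s \<omega>) (\<lambda>s. G s \<omega>) * \<psi> (X t \<omega>) (G t \<omega>) (X (Suc t) \<omega>)) =
    expectation (\<lambda>\<omega>. \<Sum>h\<in>histories t. \<Sum>j\<in>UNIV. \<Sum>b\<in>UNIV.
      f (fst h) (snd h) * \<psi> (fst h t) b j * indicator (cylinder t (fst h) (snd h) \<inter> S b j) \<omega>)"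
  proof (intro Bochner_Integration.integral_cong refl)
    fix \<omega> assume \<omega>: "\<omega> \<in> space \<Omega>"
    have "f (\<lambda>s. X s \<omega>) (\<lambda>s. G s \<omega>) * \<psi> (X t \<omega>) (G t \<omega>) (X (Suc t) \<omega>) =
      (\<Sum>h\<in>histories t. f (fst h) (snd h) *
        (indicator (cylinder t (fst h) (snd h)) \<omega> * \<psi> (X t \<omega>) (G t \<omega>) (X (Suc t) \<omega>)))"
      by (simp add: adapted_expansion[OF f \<omega>] sum_distrib_right mult.assoc)
    \<comment> \<open>On a cylinder the position at time \<open>t\<close> is that of the history, so
      it is frozen to \<open>fst h t\<close> before expanding over \<open>S\<close>.\<close>
    also have "\<dots> = (\<Sum>h\<in>histories t. f (fst h) (snd h) *
        (indicator (cylinder t (fst h) (snd h)) \<omega> * \<psi> (fst h t) (G t \<omega>) (X (Suc t) \<omega>)))"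
      by (intro sum.cong refl) (auto simp: cylinder_def split: split_indicator)
    also have "\<dots> = (\<Sum>h\<in>histories t. \<Sum>j\<in>UNIV. \<Sum>b\<in>UNIV.
      f (fst h) (snd h) * \<psi> (fst h t) b j * indicator (cylinder t (fst h) (snd h) \<inter> S b j) \<omega>)"
      unfolding \<psi>[OF \<omega>] sum_distrib_left indicator_inter_arith
      by (intro sum.cong refl) (simp only: mult_ac)
    finally show "f (\<lambda>s. X s \<omega>) (\<lambda>s. G s \<omega>) * \<psi> (X t \<omega>) (G t \<omega>) (X (Suc t) \<omega>) = \<dots>" .
  qed
  also have "\<dots> = (\<Sum>h\<in>histories t. \<Sum>j\<in>UNIV. \<Sum>b\<in>UNIV.
      f (fst h) (snd h) * \<psi> (fst h t) b j * prob (cylinder t (fst h) (snd h) \<inter> S b j))"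
    by (simp add: Bochner_Integration.integral_sum emeasure_eq_measure del: sum_mult_indicator)
  also have "\<dots> = (\<Sum>h\<in>histories t. \<Sum>j\<in>UNIV. \<Sum>b\<in>UNIV. f (fst h) (snd h) * \<psi> (fst h t) b j *
      (prob (cylinder t (fst h) (snd h)) * p (fst h t) j * q (fst h t) b))"
  proof (intro sum.cong refl)
    fix h j b
    show "f (fst h) (snd h) * \<psi> (fst h t) b j * prob (cylinder t (fst h) (snd h) \<inter> S b j) =
      f (fst h) (snd h) * \<psi> (fst h t) b j *
        (prob (cylinder t (fst h) (snd h)) * p (fst h t) j * q (fst h t) b)"
      by (cases "terminal E (fst h t)") (simp_all add: f0 S_def prob_cylinder_step)
  qed
  also have "\<dots> = (\<Sum>h\<in>histories t. f (fst h) (snd h) *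
      (\<Sum>j\<in>UNIV. \<Sum>b\<in>UNIV. p (fst h t) j * q (fst h t) b * \<psi> (fst h t) b j) *
      prob (cylinder t (fst h) (snd h)))"
    by (simp add: sum_distrib_left sum_distrib_right mult_ac)
  also have "\<dots> = expectation (\<lambda>\<omega>. f (\<lambda>s. X s \<omega>) (\<lambda>s. G s \<omega>) *
      (\<Sum>j\<in>UNIV. \<Sum>b\<in>UNIV. p (X t \<omega>) j * q (X t \<omega>) b * \<psi> (X t \<omega>) b j))"
    by (rule expectation_adapted[symmetric])
      (intro adapted_mult f adapted_at[where \<phi>="\<lambda>a. \<Sum>j\<in>UNIV. \<Sum>b\<in>UNIV. p a j * q a b * \<psi> a b j"] order_refl)
  finally show ?thesis .
qed

text \<open>Each step back in time replaces \<open>\<phi>\<close> by \<open>P *v \<phi>\<close>,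
  hence the induction over all \<open>\<phi>\<close>. Vanishing at terminal nodes is preserved
  because \<open>P\<close> fixes those entries, and it makes the restriction to nonterminal
  positions at time \<open>t\<close> automatic.\<close>

lemma expectation_alive:
  assumes q_sum: "\<And>i. \<not> terminal E i \<Longrightarrow> (\<Sum>b\<in>UNIV. q i b) = 1"
    and P: "absorbing E P" "\<And>i j. \<not> terminal E i \<Longrightarrow> p i j = P $ i $ j"
    and \<phi>: "\<And>i. terminal E i \<Longrightarrow> \<phi> $ i = 0"
  shows "expectation (\<lambda>\<omega>. of_bool (alive E (\<lambda>s. X s \<omega>) t) * \<phi> $ X t \<omega>) =
    expectation (\<lambda>\<omega>. (((*v) P) ^^ t) \<phi> $ X 0 \<omega>)"
  using \<phi>
proof (induction t arbitrary: \<phi>)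
  case 0
  show ?case by simp
next
  case (Suc t)
  have term0: "(P *v \<phi>) $ i = 0" if "terminal E i" for i
    using absorbing_terminal[OF P(1) that] Suc.prems[OF that] by simp
  let ?f = "\<lambda>x g. of_bool (alive E x t) * of_bool (\<not> terminal E (x t)) :: real"
  have f: "adapted t ?f"
    by (intro adapted_mult adapted_alive adapted_at[where \<phi>="\<lambda>i. of_bool (\<not> terminal E i)"] order_refl)
  have "expectation (\<lambda>\<omega>. of_bool (alive E (\<lambda>s. X s \<omega>) (Suc t)) * \<phi> $ X (Suc t) \<omega>) =
      expectation (\<lambda>\<omega>. ?f (\<lambda>s. X s \<omega>) (\<lambda>s. G s \<omega>) * \<phi> $ X (Suc t) \<omega>)"
    by (simp add: alive_Suc of_bool_conj)
  also have "\<dots> = expectation (\<lambda>\<omega>. ?f (\<lambda>s. X s \<omega>) (\<lambda>s. G s \<omega>) *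
      (\<Sum>j\<in>UNIV. \<Sum>b\<in>UNIV. p (X t \<omega>) j * q (X t \<omega>) b * \<phi> $ j))"
    by (rule expectation_step[OF f, where \<psi>="\<lambda>a b j. \<phi> $ j"]) simp
  also have "\<dots> = expectation (\<lambda>\<omega>. of_bool (alive E (\<lambda>s. X s \<omega>) t) * (P *v \<phi>) $ X t \<omega>)"
  proof (intro Bochner_Integration.integral_cong refl)
    fix \<omega>
    have "(\<Sum>j\<in>UNIV. \<Sum>b\<in>UNIV. p i j * q i b * \<phi> $ j) = (P *v \<phi>) $ i" if "\<not> terminal E i" for i
    proof -
      have "(\<Sum>j\<in>UNIV. \<Sum>b\<in>UNIV. p i j * q i b * \<phi> $ j) = (\<Sum>j\<in>UNIV. p i j * \<phi> $ j * (\<Sum>b\<in>UNIV. q i b))"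
        by (simp add: sum_distrib_left mult_ac)
      then show ?thesis by (simp add: q_sum[OF that] P(2)[OF that] matrix_vector_mult_def)
    qed
    then show "?f (\<lambda>s. X s \<omega>) (\<lambda>s. G s \<omega>) * (\<Sum>j\<in>UNIV. \<Sum>b\<in>UNIV. p (X t \<omega>) j * q (X t \<omega>) b * \<phi> $ j) =
        of_bool (alive E (\<lambda>s. X s \<omega>) t) * (P *v \<phi>) $ X t \<omega>"
      by (cases "terminal E (X t \<omega>)") (simp_all add: term0)
  qed
  also have "\<dots> = expectation (\<lambda>\<omega>. (((*v) P) ^^ t) (P *v \<phi>) $ X 0 \<omega>)"
    by (rule Suc.IH) (rule term0)
  finally show ?case by (simp only: funpow_swap1 funpow.simps comp_apply)
qed

text \<open>An endless game is alive at every \<open>t\<close>, so its probability is at most the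
  mean at \<open>X 0\<close> of the \<open>t\<close>-th iterate of the nonterminal indicator, which
  tends to 0.\<close>

lemma AE_duration_finite:
  assumes q_sum: "\<And>i. \<not> terminal E i \<Longrightarrow> (\<Sum>b\<in>UNIV. q i b) = 1"
    and P: "absorbing E P" "\<And>i j. \<not> terminal E i \<Longrightarrow> p i j = P $ i $ j"
    and graph: "terminating_graph E"
  shows "AE \<omega> in \<Omega>. duration E (\<lambda>t. X t \<omega>) < \<infinity>"
proof -
  let ?n = "nonterminal_indicator E"
  define B where "B = {\<omega> \<in> space \<Omega>. \<forall>t. \<not> terminal E (X t \<omega>)}"
  have [measurable]: "B \<in> sets \<Omega>" unfolding B_def by measurable
  \<comment> \<open>The sum of absolute values bounds the iterate at every node, whatever the law of
    \<open>X 0\<close>.\<close>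
  have "prob B \<le> (\<Sum>i\<in>UNIV. \<bar>(((*v) P) ^^ t) ?n $ i\<bar>)" for t
  proof -
    have int: "integrable \<Omega> (\<lambda>\<omega>. of_bool (alive E (\<lambda>s. X s \<omega>) t) * ?n $ X t \<omega>)"
      by (rule adapted_integrable[of t], intro adapted_mult adapted_alive adapted_at) simp
    have "prob B = expectation (indicator B)" by simp
    also have "\<dots> \<le> expectation (\<lambda>\<omega>. of_bool (alive E (\<lambda>s. X s \<omega>) t) * ?n $ X t \<omega>)"
      by (intro integral_mono int integrable_real_indicator)
        (auto simp: emeasure_eq_measure B_def alive_def nonterminal_indicator_def split: split_indicator)
    also have "\<dots> = expectation (\<lambda>\<omega>. (((*v) P) ^^ t) ?n $ X 0 \<omega>)"
      by (rule expectation_alive[OF q_sum P]) (auto simp: nonterminal_indicator_def)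
    also have "\<dots> \<le> (\<Sum>i\<in>UNIV. \<bar>(((*v) P) ^^ t) ?n $ i\<bar>)"
    proof (rule integral_le_const)
      show "integrable \<Omega> (\<lambda>\<omega>. (((*v) P) ^^ t) ?n $ X 0 \<omega>)"
        by (rule adapted_integrable[of 0], rule adapted_at) simp
      have "y $ i \<le> (\<Sum>i\<in>UNIV. \<bar>y $ i\<bar>)" for y :: "real^'v" and i
        using abs_ge_self[of "y $ i"] member_le_sum[of i UNIV "\<lambda>i. \<bar>y $ i\<bar>"] by simp
      then show "AE \<omega> in \<Omega>. (((*v) P) ^^ t) ?n $ X 0 \<omega> \<le> (\<Sum>i\<in>UNIV. \<bar>(((*v) P) ^^ t) ?n $ i\<bar>)"
        by (intro AE_I2)
    qed
    finally show ?thesis .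
  qed
  moreover have "(\<lambda>t. \<Sum>i\<in>UNIV. \<bar>(((*v) P) ^^ t) ?n $ i\<bar>) \<longlonglongrightarrow> (\<Sum>i\<in>(UNIV::'v set). \<bar>0 $ i\<bar>)"
    by (intro tendsto_intros absorbing_nonterminal_tendsto_0[OF graph P(1)])
  ultimately have "prob B \<le> (\<Sum>i\<in>(UNIV::'v set). \<bar>0 $ i\<bar>)"
    by (intro LIMSEQ_le_const) auto
  then have "prob B = 0" by (simp add: measure_le_0_iff)
  then have "AE \<omega> in \<Omega>. \<omega> \<notin> B" by (simp add: prob_eq_0)
  then show ?thesis using AE_space
  proof eventually_elim
    case (elim \<omega>)
    then show ?case unfolding duration_finite_iff by (auto simp: B_def)
  qed
qed

text \<open>The test function \<open>\<phi>\<close> replaces conditioning on the current position; with \<open>\<phi> = 1\<close> alone the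
  induction would not isolate the event that the game ends at time \<open>t\<close>.\<close>

lemma expectation_fortune:
  assumes q_sum: "\<And>i. \<not> terminal E i \<Longrightarrow> (\<Sum>b\<in>UNIV. q i b) = 1"
    and fair: "\<And>i j. \<not> terminal E i \<Longrightarrow>
      p i j * v j * (\<Sum>b\<in>UNIV. q i b * fortune_factor E w i b j) = v i * p i j"
  shows "expectation (\<lambda>\<omega>. of_bool (X 0 \<omega> = i) * of_bool (alive E (\<lambda>s. X s \<omega>) t) *
      fortune E w (\<lambda>s. X s \<omega>) (\<lambda>s. G s \<omega>) t * v (X t \<omega>) * \<phi> (X t \<omega>)) =
    v i * expectation (\<lambda>\<omega>. of_bool (X 0 \<omega> = i) * of_bool (alive E (\<lambda>s. X s \<omega>) t) * \<phi> (X t \<omega>))"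
proof (induction t arbitrary: \<phi>)
  case 0
  have "expectation (\<lambda>\<omega>. of_bool (X 0 \<omega> = i) * v (X 0 \<omega>) * \<phi> (X 0 \<omega>)) =
      expectation (\<lambda>\<omega>. v i * (of_bool (X 0 \<omega> = i) * \<phi> (X 0 \<omega>)))"
    by (intro Bochner_Integration.integral_cong) auto
  then show ?case by (simp add: fortune_def)
next
  case (Suc t)
  let ?a = "\<lambda>x g. of_bool (x 0 = i) * of_bool (alive E x t) * of_bool (\<not> terminal E (x t)) :: real"
  \<comment> \<open>The one-step mean of \<open>\<phi>\<close>, cut off at terminal nodes: what
    remains once \<open>fair\<close> has absorbed the fortune factor into \<open>v\<close>.\<close>
  define \<phi>' where "\<phi>' k = of_bool (\<not> terminal E k) * (\<Sum>j\<in>UNIV. p k j * \<phi> j)" for k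
  have a: "adapted t ?a"
    by (intro adapted_mult adapted_alive adapted_at[where \<phi>="\<lambda>k. of_bool (\<not> terminal E k)"]
        adapted_at[where \<phi>="\<lambda>k. of_bool (k = i)"]) auto
  have af: "adapted t (\<lambda>x g. ?a x g * fortune E w x g t)"
    by (intro adapted_mult[OF a] adapted_fortune)
  have "expectation (\<lambda>\<omega>. of_bool (X 0 \<omega> = i) * of_bool (alive E (\<lambda>s. X s \<omega>) (Suc t)) *
      fortune E w (\<lambda>s. X s \<omega>) (\<lambda>s. G s \<omega>) (Suc t) * v (X (Suc t) \<omega>) * \<phi> (X (Suc t) \<omega>)) =
    expectation (\<lambda>\<omega>. (?a (\<lambda>s. X s \<omega>) (\<lambda>s. G s \<omega>) * fortune E w (\<lambda>s. X s \<omega>) (\<lambda>s. G s \<omega>) t) *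
      (fortune_factor E w (X t \<omega>) (G t \<omega>) (X (Suc t) \<omega>) * v (X (Suc t) \<omega>) * \<phi> (X (Suc t) \<omega>)))"
    by (simp add: alive_Suc of_bool_conj fortune_def mult_ac)
  also have "\<dots> = expectation (\<lambda>\<omega>. (?a (\<lambda>s. X s \<omega>) (\<lambda>s. G s \<omega>) * fortune E w (\<lambda>s. X s \<omega>) (\<lambda>s. G s \<omega>) t) *
      (\<Sum>j\<in>UNIV. \<Sum>b\<in>UNIV. p (X t \<omega>) j * q (X t \<omega>) b * (fortune_factor E w (X t \<omega>) b j * v j * \<phi> j)))"
    by (rule expectation_step[OF af, where \<psi>="\<lambda>k b j. fortune_factor E w k b j * v j * \<phi> j"]) simp
  also have "\<dots> = expectation (\<lambda>\<omega>. of_bool (X 0 \<omega> = i) * of_bool (alive E (\<lambda>s. X s \<omega>) t) *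
      fortune E w (\<lambda>s. X s \<omega>) (\<lambda>s. G s \<omega>) t * v (X t \<omega>) * \<phi>' (X t \<omega>))"
  proof (intro Bochner_Integration.integral_cong refl)
    fix \<omega>
    have "(\<Sum>j\<in>UNIV. \<Sum>b\<in>UNIV. p k j * q k b * (fortune_factor E w k b j * v j * \<phi> j)) = v k * \<phi>' k"
      if "\<not> terminal E k" for k
    proof -
      have "(\<Sum>j\<in>UNIV. \<Sum>b\<in>UNIV. p k j * q k b * (fortune_factor E w k b j * v j * \<phi> j)) =
        (\<Sum>j\<in>UNIV. (p k j * v j * (\<Sum>b\<in>UNIV. q k b * fortune_factor E w k b j)) * \<phi> j)"
        by (simp add: sum_distrib_left sum_distrib_right mult_ac)
      also have "\<dots> = v k * \<phi>' k"
        unfolding fair[OF that] using that by (simp add: \<phi>'_def sum_distrib_left mult_ac)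
      finally show ?thesis .
    qed
    then show "(?a (\<lambda>s. X s \<omega>) (\<lambda>s. G s \<omega>) * fortune E w (\<lambda>s. X s \<omega>) (\<lambda>s. G s \<omega>) t) *
      (\<Sum>j\<in>UNIV. \<Sum>b\<in>UNIV. p (X t \<omega>) j * q (X t \<omega>) b * (fortune_factor E w (X t \<omega>) b j * v j * \<phi> j)) =
      of_bool (X 0 \<omega> = i) * of_bool (alive E (\<lambda>s. X s \<omega>) t) *
      fortune E w (\<lambda>s. X s \<omega>) (\<lambda>s. G s \<omega>) t * v (X t \<omega>) * \<phi>' (X t \<omega>)"
      by (cases "terminal E (X t \<omega>)") (simp_all add: \<phi>'_def)
  qed
  also have "\<dots> = v i * expectation (\<lambda>\<omega>. of_bool (X 0 \<omega> = i) * of_bool (alive E (\<lambda>s. X s \<omega>) t) * \<phi>' (X t \<omega>))"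
    by (rule Suc.IH)
  \<comment> \<open>The same step is now undone without the fortune, turning \<open>\<phi>'\<close>
    at time \<open>t\<close> back into \<open>\<phi>\<close> at time \<open>Suc t\<close>.\<close>
  also have "expectation (\<lambda>\<omega>. of_bool (X 0 \<omega> = i) * of_bool (alive E (\<lambda>s. X s \<omega>) t) * \<phi>' (X t \<omega>)) =
      expectation (\<lambda>\<omega>. ?a (\<lambda>s. X s \<omega>) (\<lambda>s. G s \<omega>) *
        (\<Sum>j\<in>UNIV. \<Sum>b\<in>UNIV. p (X t \<omega>) j * q (X t \<omega>) b * \<phi> j))"
  proof (intro Bochner_Integration.integral_cong refl)
    fix \<omega>
    have "(\<Sum>j\<in>UNIV. \<Sum>b\<in>UNIV. p k j * q k b * \<phi> j) = (\<Sum>j\<in>UNIV. p k j * \<phi> j)"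
      if "\<not> terminal E k" for k
    proof -
      have "(\<Sum>j\<in>UNIV. \<Sum>b\<in>UNIV. p k j * q k b * \<phi> j) = (\<Sum>j\<in>UNIV. p k j * \<phi> j * (\<Sum>b\<in>UNIV. q k b))"
        by (simp add: sum_distrib_left mult_ac)
      then show ?thesis by (simp add: q_sum[OF that])
    qed
    then show "of_bool (X 0 \<omega> = i) * of_bool (alive E (\<lambda>s. X s \<omega>) t) * \<phi>' (X t \<omega>) =
      ?a (\<lambda>s. X s \<omega>) (\<lambda>s. G s \<omega>) * (\<Sum>j\<in>UNIV. \<Sum>b\<in>UNIV. p (X t \<omega>) j * q (X t \<omega>) b * \<phi> j)"
      by (cases "terminal E (X t \<omega>)") (simp_all add: \<phi>'_def)
  qed
  also have "\<dots> = expectation (\<lambda>\<omega>. ?a (\<lambda>s. X s \<omega>) (\<lambda>s. G s \<omega>) * \<phi> (X (Suc t) \<omega>))"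
    by (rule expectation_step[OF a, where \<psi>="\<lambda>k b j. \<phi> j", symmetric]) simp
  finally show ?case by (simp add: alive_Suc of_bool_conj mult_ac)
qed

text \<open>The events \<open>D t\<close> partition the starting event up to a null set, and each
  contributes \<open>v i\<close> times its probability. All terms are nonnegative, so summation and
  integration commute, and integrability is obtained along the way.\<close>

lemma final_fortune_expectation:
  assumes q_sum: "\<And>i. \<not> terminal E i \<Longrightarrow> (\<Sum>b\<in>UNIV. q i b) = 1"
    and fair: "\<And>i j. \<not> terminal E i \<Longrightarrow>
      p i j * v j * (\<Sum>b\<in>UNIV. q i b * fortune_factor E w i b j) = v i * p i j"
    and wager: "\<And>i. \<not> terminal E i \<Longrightarrow> 0 \<le> w i \<and> w i \<le> 1"
    and v: "\<And>i. 0 < v i" "\<And>i. terminal E i \<Longrightarrow> v i = val i"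
    and terminates: "AE \<omega> in \<Omega>. duration E (\<lambda>t. X t \<omega>) < \<infinity>"
    and start: "0 < prob {\<omega> \<in> space \<Omega>. X 0 \<omega> = i}"
  shows "has_bochner_integral (uniform_measure \<Omega> {\<omega> \<in> space \<Omega>. X 0 \<omega> = i})
    (\<lambda>\<omega>. final_fortune E val w (\<lambda>t. X t \<omega>) (\<lambda>t. G t \<omega>)) (v i)"
proof -
  define A where "A = {\<omega> \<in> space \<Omega>. X 0 \<omega> = i}"
  define F where "F \<omega> = final_fortune E val w (\<lambda>t. X t \<omega>) (\<lambda>t. G t \<omega>)" for \<omega>
  define y where "y t x g = of_bool (alive E x t \<and> terminal E (x t)) * fortune E w x g t * val (x t)"
    for t x g
  define Y where "Y t \<omega> = y t (\<lambda>s. X s \<omega>) (\<lambda>s. G s \<omega>)" for t \<omega>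
  define D where "D t = {\<omega> \<in> space \<Omega>. X 0 \<omega> = i \<and> duration E (\<lambda>s. X s \<omega>) = enat t}" for t
  have A [measurable]: "A \<in> sets \<Omega>" unfolding A_def by measurable
  have D [measurable]: "D t \<in> sets \<Omega>" for t
    unfolding D_def duration_eq_enat_iff alive_def by measurable
  have y: "adapted t (y t)" for t
    unfolding y_def of_bool_conj
    by (intro adapted_mult adapted_alive adapted_fortune
        adapted_at[where \<phi>="\<lambda>k. of_bool (terminal E k)"] adapted_at[where \<phi>=val] order_refl)
  have Y [measurable]: "Y t \<in> borel_measurable \<Omega>" for t
    using adapted_integrable[OF y] by (auto simp: Y_def[abs_def])
  have factor: "0 \<le> fortune_factor E w k b j" if "\<not> terminal E k" for k b j
  proof -
    have "1 \<le> out_degree E k" using that by (simp add: terminal_def)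
    then show ?thesis using wager[OF that] by (simp add: fortune_factor_def)
  qed
  \<comment> \<open>The indicator in \<open>y\<close> confines \<open>val\<close> to terminal nodes,
    where it equals the positive \<open>v\<close>, and the fortune to moves from nonterminal nodes,
    where \<open>factor\<close> applies.\<close>
  have Y_nonneg: "0 \<le> Y t \<omega>" for t \<omega>
    using v by (auto simp: Y_def y_def fortune_def alive_def intro!: mult_nonneg_nonneg prod_nonneg factor)
      (metis less_imp_le v)
  have Y_sums: "(\<lambda>t. Y t \<omega>) sums F \<omega>" for \<omega>
    unfolding Y_def y_def F_def by (rule final_fortune_sums)
  then have F_eq: "F = (\<lambda>\<omega>. \<Sum>t. Y t \<omega>)" by (auto simp: sums_iff)
  have F [measurable]: "F \<in> borel_measurable \<Omega>" unfolding F_eq by measurable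
  have Y_int: "(\<integral>\<^sup>+\<omega>. ennreal (Y t \<omega>) * indicator A \<omega> \<partial>\<Omega>) = ennreal (v i) * emeasure \<Omega> (D t)" for t
  proof -
    have int: "integrable \<Omega> (\<lambda>\<omega>. Y t \<omega> * indicator A \<omega>)"
      unfolding Y_def by (rule integrable_real_mult_indicator[OF A adapted_integrable[OF y]])
    have "(\<integral>\<^sup>+\<omega>. ennreal (Y t \<omega>) * indicator A \<omega> \<partial>\<Omega>) = (\<integral>\<^sup>+\<omega>. ennreal (Y t \<omega> * indicator A \<omega>) \<partial>\<Omega>)"
      by (intro nn_integral_cong) (simp split: split_indicator)
    also have "\<dots> = ennreal (expectation (\<lambda>\<omega>. Y t \<omega> * indicator A \<omega>))"
      by (rule nn_integral_eq_integral[OF int]) (simp add: Y_nonneg)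
    also have "expectation (\<lambda>\<omega>. Y t \<omega> * indicator A \<omega>) =
      expectation (\<lambda>\<omega>. of_bool (X 0 \<omega> = i) * of_bool (alive E (\<lambda>s. X s \<omega>) t) *
        fortune E w (\<lambda>s. X s \<omega>) (\<lambda>s. G s \<omega>) t * v (X t \<omega>) * of_bool (terminal E (X t \<omega>)))"
      by (intro Bochner_Integration.integral_cong refl) (auto simp: Y_def y_def A_def v(2))
    \<comment> \<open>The test function is the indicator of the terminal nodes, which isolates play
      ending at time \<open>t\<close>.\<close>
    also have "\<dots> = v i * expectation (\<lambda>\<omega>. of_bool (X 0 \<omega> = i) *
        of_bool (alive E (\<lambda>s. X s \<omega>) t) * of_bool (terminal E (X t \<omega>)))"
      by (rule expectation_fortune[OF q_sum fair])
    also have "expectation (\<lambda>\<omega>. of_bool (X 0 \<omega> = i) *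
        of_bool (alive E (\<lambda>s. X s \<omega>) t) * of_bool (terminal E (X t \<omega>)) :: real) =
        expectation (indicator (D t))"
      by (intro Bochner_Integration.integral_cong refl) (auto simp: D_def duration_eq_enat_iff)
    finally show ?thesis
      using v(1)[of i] by (simp add: emeasure_eq_measure ennreal_mult)
  qed
  have "(\<integral>\<^sup>+\<omega>. ennreal (F \<omega>) * indicator A \<omega> \<partial>\<Omega>) = (\<integral>\<^sup>+\<omega>. (\<Sum>t. ennreal (Y t \<omega>) * indicator A \<omega>) \<partial>\<Omega>)"
    using suminf_ennreal_eq[OF Y_nonneg Y_sums] by simp
  also have "\<dots> = (\<Sum>t. ennreal (v i) * emeasure \<Omega> (D t))"
    by (subst nn_integral_suminf) (simp_all add: Y_int)
  also have "\<dots> = ennreal (v i) * emeasure \<Omega> (\<Union>t. D t)"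
    using D by (subst suminf_emeasure[symmetric]) (auto simp: disjoint_family_on_def D_def[abs_def])
  also have "emeasure \<Omega> (\<Union>t. D t) = emeasure \<Omega> A"
  proof (rule emeasure_eq_AE)
    show "AE \<omega> in \<Omega>. \<omega> \<in> (\<Union>t. D t) \<longleftrightarrow> \<omega> \<in> A"
      using terminates by eventually_elim (auto simp: D_def A_def)
  qed auto
  finally have "(\<integral>\<^sup>+\<omega>. ennreal (F \<omega>) \<partial>uniform_measure \<Omega> A) = ennreal (v i) * emeasure \<Omega> A / emeasure \<Omega> A"
    by (subst nn_integral_uniform_measure) auto
  also have "\<dots> = ennreal (v i)"
    using start v(1)[of i]
    by (simp add: A_def emeasure_eq_measure divide_ennreal ennreal_mult[symmetric] less_imp_le)
  finally have "has_bochner_integral (uniform_measure \<Omega> A) F (v i)"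
    using v(1)[of i] Y_nonneg sums_le[OF _ sums_zero Y_sums]
    by (intro has_bochner_integral_nn_integral) (auto simp: less_imp_le)
  then show ?thesis by (simp add: A_def F_def[abs_def])
qed

end

theorem theorem3:
  fixes E :: "('v::finite \<times> 'v) set" and val :: "'v \<Rightarrow> real"
    and \<beta> :: real and q :: "'v \<Rightarrow> 'v \<Rightarrow> real"
  assumes "terminating_graph E"
    and "\<And>j. terminal E j \<Longrightarrow> 0 < val j"
    and "0 < \<beta>" and "\<beta> \<le> 1"
    and "limiting_guesses E val \<beta> q"
  shows "chooser_matrix E val =
           diag (limiting_value E val) ** propagation_matrix E ** matrix_inv (diag (limiting_value E val))
    \<and> (\<forall>(\<Omega> :: 'w measure) X G.
         path_guessing_play E (\<lambda>i j. chooser_matrix E val $ i $ j) q \<Omega> X G \<longrightarrow>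
           (AE \<omega> in \<Omega>. duration E (\<lambda>t. X t \<omega>) < \<infinity>) \<and>
           (\<forall>i. 0 < measure \<Omega> {\<omega> \<in> space \<Omega>. X 0 \<omega> = i} \<longrightarrow>
              (let \<Omega>\<^sub>i = uniform_measure \<Omega> {\<omega> \<in> space \<Omega>. X 0 \<omega> = i};
                   F = (\<lambda>\<omega>. final_fortune E val (limiting_wager E val \<beta>) (\<lambda>t. X t \<omega>) (\<lambda>t. G t \<omega>))
               in integrable \<Omega>\<^sub>i F \<and> integral\<^sup>L \<Omega>\<^sub>i F = limiting_value E val $ i)))"
proof (intro conjI allI impI)
  show "chooser_matrix E val =
      diag (limiting_value E val) ** propagation_matrix E ** matrix_inv (diag (limiting_value E val))"
    by (rule chooser_matrix_conjugate[OF assms(1,2)])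
next
  fix \<Omega> :: "'w measure" and X G
  assume "path_guessing_play E (\<lambda>i j. chooser_matrix E val $ i $ j) q \<Omega> X G"
  then interpret path_guessing_play E "\<lambda>i j. chooser_matrix E val $ i $ j" q \<Omega> X G .
  let ?u = "limiting_reciprocal E val" and ?v = "limiting_value E val" and ?w = "limiting_wager E val \<beta>"
  have u: "0 < ?u $ i" for i by (rule limiting_reciprocal_fixpoint[OF assms(1,2)])
  have q_sum: "(\<Sum>b\<in>UNIV. q i b) = 1" if "\<not> terminal E i" for i
    by (rule guess_row_sum[OF assms that])
  show fin: "AE \<omega> in \<Omega>. duration E (\<lambda>t. X t \<omega>) < \<infinity>"
    by (rule AE_duration_finite[OF q_sum chooser_matrix_absorbing[OF assms(1,2)] refl assms(1)])
  fix i
  assume start: "0 < prob {\<omega> \<in> space \<Omega>. X 0 \<omega> = i}"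
  \<comment> \<open>Along an edge \<open>?v $ j * ?u $ j = 1\<close>, so the mean factor
    \<open>?u $ j / ?u $ k\<close> turns the value of \<open>j\<close> into that of
    \<open>k\<close>. Off the edges the Chooser's probability is 0 and so are both sides.\<close>
  have fair: "chooser_matrix E val $ k $ j * ?v $ j *
      (\<Sum>b\<in>UNIV. q k b * fortune_factor E ?w k b j) = ?v $ k * chooser_matrix E val $ k $ j"
    if "\<not> terminal E k" for k j
  proof (cases "(k, j) \<in> E")
    case True
    have "(\<Sum>b\<in>UNIV. q k b * fortune_factor E ?w k b j) = ?u $ j / ?u $ k"
      by (rule expected_fortune_factor[OF assms True])
    then show ?thesis using u[of j] u[of k] by (simp add: limiting_value_def divide_inverse mult_ac)
  next
    case False
    then show ?thesis using that by (simp add: chooser_matrix_def)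
  qed
  have "has_bochner_integral (uniform_measure \<Omega> {\<omega> \<in> space \<Omega>. X 0 \<omega> = i})
    (\<lambda>\<omega>. final_fortune E val ?w (\<lambda>t. X t \<omega>) (\<lambda>t. G t \<omega>)) (?v $ i)"
    by (rule final_fortune_expectation[where v="\<lambda>k. ?v $ k", OF q_sum fair _ _ _ fin start])
      (auto simp: limiting_wager_bounds[OF assms] limiting_value_def u
        limiting_reciprocal_fixpoint(3)[OF assms(1,2)])
  then show "let \<Omega>\<^sub>i = uniform_measure \<Omega> {\<omega> \<in> space \<Omega>. X 0 \<omega> = i};
        F = (\<lambda>\<omega>. final_fortune E val ?w (\<lambda>t. X t \<omega>) (\<lambda>t. G t \<omega>))
      in integrable \<Omega>\<^sub>i F \<and> integral\<^sup>L \<Omega>\<^sub>i F = ?v $ i"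
    by (simp add: has_bochner_integral_iff)
qed

end
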